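(* Let $m>0$ be an integer with $m\equiv 0,1,2,4,6$ or $7\pmod 8$. Then the graph $G_{2,m,2}$ contains a (directed) Hamiltonian cycle.
   Context: For positive integers $n,m$, the graph $G_{n,m,2}$ (an augmented directed grid graph on a two-holed torus) is defined as follows. Its vertices are the $4nm$ cells $(i,c)$ of a grid with $2n$ rows $0\le i<2n$ (row $0$ on top) and $2m$ columns $0\le c<2m$ (column $0$ leftmost). The bijection $u$ ("up") on cells is $u(i,c)=(i-1,c)$ if $i\ge 1$, and $u(0,c)=(2n-1,(c+m)\bmod 2m)$. The bijection $r$ ("right") on cells is $r(i,c)=(i,c+1)$ if $c<2m-1$, and $r(i,2m-1)=((i+n)\bmod 2n,0)$. The directed edges are $(\alpha,u\alpha)$ and $(\alpha,r\alpha)$ for every cell $\alpha$. A Hamiltonian cycle is a directed cycle visiting every vertex exactly once. *)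

theory Defs
  imports Graph_Theory.Graph_Theory
begin

text \<open>
  A cell is a pair (row, column), with row 0 on top and column 0 leftmost.
  The maps below are meaningful on \<open>grid_cells n m\<close> for positive \<open>n\<close> and \<open>m\<close>.
\<close>

definition grid_cells :: "nat \<Rightarrow> nat \<Rightarrow> (nat \<times> nat) set" where
  "grid_cells n m = {0..<2 * n} \<times> {0..<2 * m}"

fun grid_up :: "nat \<Rightarrow> nat \<Rightarrow> nat \<times> nat \<Rightarrow> nat \<times> nat" where
  "grid_up n m (i, c) =
     (if i \<ge> 1 then (i - 1, c) else (2 * n - 1, (c + m) mod (2 * m)))"

fun grid_right :: "nat \<Rightarrow> nat \<Rightarrow> nat \<times> nat \<Rightarrow> nat \<times> nat" where
  "grid_right n m (i, c) =
     (if c < 2 * m - 1 then (i, c + 1) else ((i + n) mod (2 * n), 0))"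

definition two_holed_grid ::
    "nat \<Rightarrow> nat \<Rightarrow> (nat \<times> nat, (nat \<times> nat) \<times> (nat \<times> nat)) pre_digraph" where
  "two_holed_grid n m =
     \<lparr> verts = grid_cells n m,
       arcs = {(\<alpha>, grid_up n m \<alpha>) | \<alpha>. \<alpha> \<in> grid_cells n m} \<union>
              {(\<alpha>, grid_right n m \<alpha>) | \<alpha>. \<alpha> \<in> grid_cells n m},
       tail = fst,
       head = snd \<rparr>"

text \<open>
  A cycle in the library's sense repeats no vertex except that its first and last
  vertices coincide, so it remains to require that all vertices occur on it.
\<close>

definition (in pre_digraph) hamiltonian_cycle :: "'b awalk \<Rightarrow> bool" where
  "hamiltonian_cycle p \<longleftrightarrow>
     cycle p \<and> (\<exists>u. awalk u p u \<and> set (awalk_verts u p) = verts G)"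

lemma grid_up_bij:
  assumes "n > 0" "m > 0"
  shows "bij_betw (grid_up n m) (grid_cells n m) (grid_cells n m)"
proof -
  have shift: "((c + m) mod (2 * m) + m) mod (2 * m) = c" if "c < 2 * m" for c
    using that by (simp add: mod_add_left_eq add.assoc flip: mult_2)
  show ?thesis
    by (rule bij_betw_byWitness[where f' = "\<lambda>(i, c).
          if i = 2 * n - 1 then (0, (c + m) mod (2 * m)) else (i + 1, c)"])
      (use assms shift in \<open>auto simp: grid_cells_def split: if_splits\<close>)
qed

lemma grid_right_bij:
  assumes "n > 0" "m > 0"
  shows "bij_betw (grid_right n m) (grid_cells n m) (grid_cells n m)"
proof -
  have shift: "((i + n) mod (2 * n) + n) mod (2 * n) = i" if "i < 2 * n" for i
    using that by (simp add: mod_add_left_eq add.assoc flip: mult_2)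
  show ?thesis
    by (rule bij_betw_byWitness[where f' = "\<lambda>(i, c).
          if c = 0 then ((i + n) mod (2 * n), 2 * m - 1) else (i, c - 1)"])
      (use assms shift in \<open>auto simp: grid_cells_def split: if_splits\<close>)
qed

lemma fin_digraph_two_holed_grid:
  assumes "n > 0" "m > 0"
  shows "fin_digraph (two_holed_grid n m)"
proof
  show "finite (verts (two_holed_grid n m))"
    by (simp add: two_holed_grid_def grid_cells_def)
  then show "finite (arcs (two_holed_grid n m))"
    unfolding two_holed_grid_def Setcompr_eq_image by (simp del: split_paired_Ex)
qed (use bij_betwE[OF grid_up_bij[OF assms]] bij_betwE[OF grid_right_bij[OF assms]]
      in \<open>auto simp: two_holed_grid_def\<close>)

end

(*
  Ordering the vertices along a Hamiltonian cycle, call a vertex of type U or R according to the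
  arc by which the cycle leaves it. Two arcs entering the same vertex cannot both be used, so the
  type is constant on the diagonals, the orbits of r^-1 u. Cutting the four-row grid in two halves
  and stacking these gives a strip with m columns and eight cyclic rows, in which a choice of types
  becomes a set T of diagonals mod 8. Every eight steps inside the strip return to the same
  diagonal and advance by |T| columns, so the path is controlled by the twist at the end of the
  strip alone, which depends only on m mod 8. It remains to find T such that the entries of the
  first column form a single cycle: one diagonal suffices for m = 2, 4, 6 and four diagonals for
  m = 0, 1, 7 (mod 8).
*)

theory Submission
  imports Defs
begin

section \<open>Hamiltonian cycles as orbits of a step function\<close>

lemma (in wf_digraph) hamiltonian_cycle_if_orbit:
  assumes x: "x \<in> orbit f x"
    and bij: "bij_betw \<phi> (orbit f x) (verts G)"
    and arc: "\<And>y. y \<in> orbit f x \<Longrightarrow> \<exists>a\<in>arcs G. tail G a = \<phi> y \<and> head G a = \<phi> (f y)"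
  shows "\<exists>p. hamiltonian_cycle p"
proof -
  obtain a where a: "\<And>y. y \<in> orbit f x \<Longrightarrow>
      a y \<in> arcs G \<and> tail G (a y) = \<phi> y \<and> head G (a y) = \<phi> (f y)"
    using arc by metis
  \<comment> \<open>\<open>N\<close> is the first return time to \<open>x\<close>, so the first
    \<open>N\<close> iterates list the orbit without repetition.\<close>
  define N where "N = funpow_dist1 f x x"
  define p where "p = map (\<lambda>i. a ((f ^^ i) x)) [0..<N]"
  have orb: "(f ^^ i) x \<in> orbit f x" for i
    by (rule funpow_in_orbit[OF x])
  have "awalk (\<phi> x) (map (\<lambda>i. a ((f ^^ i) x)) [0..<k]) (\<phi> ((f ^^ k) x))" for k
  proof (induction k)
    case 0
    show ?case
      using bij_betwE[OF bij] x by (simp add: awalk_Nil_iff)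
  next
    case (Suc k)
    have "awalk (\<phi> ((f ^^ k) x)) [a ((f ^^ k) x)] (\<phi> ((f ^^ Suc k) x))"
      using a[OF orb[of k]] arc_implies_awalk by fastforce
    with Suc show ?case
      by (simp add: awalk_appendI)
  qed
  then have walk: "awalk (\<phi> x) p (\<phi> x)"
    using funpow_dist1_prop[OF x] unfolding p_def N_def by metis
  have ne: "p \<noteq> []"
    by (simp add: p_def N_def)
  have tails: "map (tail G) p = map \<phi> (map (\<lambda>i. (f ^^ i) x) [0..<N])"
    using a[OF orb] by (simp add: p_def)
  have set_orb: "set (map (\<lambda>i. (f ^^ i) x) [0..<N]) = orbit f x"
    using orbit_conv_funpow_dist1[OF x] by (simp only: N_def set_map set_upt)
  have "distinct (map (\<lambda>i. (f ^^ i) x) [0..<N])"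
    using inj_on_funpow_dist1[OF x] by (simp only: distinct_map N_def set_upt distinct_upt simp_thms)
  then have dist: "distinct (map (tail G) p)"
    unfolding tails distinct_map[of \<phi>] set_orb using bij by (simp add: bij_betw_def)
  have set_tails: "set (map (tail G) p) = verts G"
    unfolding tails set_map[of \<phi>] set_orb using bij by (simp add: bij_betw_def)
  have vs: "awalk_verts (\<phi> x) p = map (tail G) p @ [\<phi> x]"
    using walk ne by (simp add: awalk_verts_conv awalk_conv)
  have "hd (map (tail G) p) = \<phi> x"
    using walk ne by (cases p) (auto simp: awalk_def)
  then have "map (tail G) p = \<phi> x # tl (map (tail G) p)"
    using ne by (metis list.collapse map_is_Nil_conv)
  \<comment> \<open>Dropping the first vertex of the closed walk leaves the list of tails rotated by
    one.\<close>
  then have "distinct (tl (awalk_verts (\<phi> x) p))"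
    and "set (awalk_verts (\<phi> x) p) = verts G"
    using dist set_tails unfolding vs
    by (metis append_Cons distinct.simps(2) distinct1_rotate list.sel(3) rotate1.simps(2))
      (use set_tails bij_betwE[OF bij] x in auto)
  then show ?thesis
    unfolding hamiltonian_cycle_def cycle_def using walk ne by blast
qed

section \<open>The eight-row strip and its diagonals\<close>

text \<open>
  The two halves of the four-row grid, the columns below \<open>m\<close> and the columns from \<open>m\<close> on, are
  stacked into one strip of \<open>m\<close> columns whose eight rows are cyclic under \<^const>\<open>grid_up\<close>.
  A pair \<open>(c, e)\<close> stands for the cell in column \<open>c\<close> and row \<open>(e + c) mod 8\<close> of this strip, so
  that \<open>e\<close> numbers the diagonals and both kinds of arcs decrease \<open>e\<close> by one, except when the last
  column is left.
\<close>

definition strip_cell :: "nat \<Rightarrow> nat \<times> nat \<Rightarrow> nat \<times> nat" where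
  "strip_cell m = (\<lambda>(c, e). let k = (e + c) mod 8 in (k mod 4, if k < 4 then c else c + m))"

text \<open>Strip row in which column 0 is entered from strip row \<open>k\<close> of the last
  column: the left half leads to the same grid row of the right half, the right half wraps around
  with a shift by two rows.\<close>

definition strip_twist :: "nat \<Rightarrow> nat" where
  "strip_twist k = (if k < 4 then k + 4 else (k + 2) mod 4)"

text \<open>\<open>T\<close> collects the diagonals left by right arcs. The argument of
  \<open>strip_twist\<close> is the row \<open>e + (m - 1)\<close> modulo 8 of a cell in the last
  column; writing \<open>m mod 8\<close> lets a known residue be substituted.\<close>

definition strip_step :: "nat set \<Rightarrow> nat \<Rightarrow> nat \<times> nat \<Rightarrow> nat \<times> nat" where
  "strip_step T m = (\<lambda>(c, e).
     if e \<notin> T then (c, (e + 7) mod 8)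
     else if c + 1 < m then (c + 1, (e + 7) mod 8)
     else (0, strip_twist ((e + m mod 8 + 7) mod 8)))"

lemma add_mod_8_inverse:
  fixes e c :: nat
  assumes "e < 8"
  shows "((e + c) mod 8 + 7 * c) mod 8 = e" "((e + 7 * c) mod 8 + c) mod 8 = e"
proof -
  have "((e + c) mod 8 + 7 * c) mod 8 = (e + 8 * c) mod 8"
    "((e + 7 * c) mod 8 + c) mod 8 = (e + 8 * c) mod 8"
    by (simp_all only: mod_add_left_eq) (simp_all add: algebra_simps)
  with assms show "((e + c) mod 8 + 7 * c) mod 8 = e" "((e + 7 * c) mod 8 + c) mod 8 = e"
    by simp_all
qed

lemma bij_betw_strip_cell:
  "bij_betw (strip_cell m) ({0..<m} \<times> {0..<8}) (grid_cells 2 m)"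
proof (rule bij_betw_byWitness)
  \<comment> \<open>Modulo 8, adding \<open>7 * c'\<close> subtracts \<open>c'\<close>, which
    recovers the diagonal from the row.\<close>
  let ?g = "\<lambda>(i, c). let c' = if c < m then c else c - m; k = if c < m then i else i + 4
    in (c', (k + 7 * c') mod 8)"
  show "\<forall>x\<in>{0..<m} \<times> {0..<8}. ?g (strip_cell m x) = x"
  proof clarify
    fix c e :: nat
    assume "c \<in> {0..<m}" "e \<in> {0..<8}"
    moreover define k where "k = (e + c) mod 8"
    moreover have "k mod 4 = (if k < 4 then k else k - 4)"
      by (simp add: k_def mod_if[of _ 4])
    ultimately show "?g (strip_cell m (c, e)) = (c, e)"
      using add_mod_8_inverse(1)[of e c] by (simp add: strip_cell_def Let_def flip: k_def)
  qed
  show "\<forall>x\<in>grid_cells 2 m. strip_cell m (?g x) = x"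
    by (auto simp: strip_cell_def Let_def grid_cells_def add_mod_8_inverse(2))
  show "strip_cell m ` ({0..<m} \<times> {0..<8}) \<subseteq> grid_cells 2 m"
    by (auto simp: strip_cell_def Let_def grid_cells_def)
  show "?g ` grid_cells 2 m \<subseteq> {0..<m} \<times> {0..<8}"
    by (auto simp: grid_cells_def Let_def)
qed

lemma strip_step_arc:
  assumes x: "x \<in> {0..<m} \<times> {0..<8}"
  shows "(strip_cell m x, strip_cell m (strip_step T m x)) \<in> arcs (two_holed_grid 2 m)"
proof -
  obtain c e where ce: "x = (c, e)" "c < m" "e < 8"
    using x by auto
  define k where "k = (e + c) mod 8"
  have k: "k \<in> {0, 1, 2, 3, 4, 5, 6, 7}"
    unfolding k_def by (simp; presburger)
  have cell: "strip_cell m x \<in> grid_cells 2 m"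
    using bij_betw_strip_cell x by (rule bij_betw_apply)
  have row: "strip_cell m x = (k mod 4, if k < 4 then c else c + m)"
    by (simp add: ce strip_cell_def Let_def k_def)
  \<comment> \<open>Going up from the top row of either half leads to the bottom row of the other,
    so the eight rows are cyclic.\<close>
  have shift: "(c + m) mod (2 * m) = c + m" "(c + m + m) mod (2 * m) = c"
    using ce(2) by (simp_all add: add.assoc flip: mult_2)
  consider (up) "e \<notin> T" | (right) "e \<in> T" "c + 1 < m" | (wrap) "e \<in> T" "c + 1 = m"
    using ce by linarith
  then have "strip_cell m (strip_step T m x)
    \<in> {grid_up 2 m (strip_cell m x), grid_right 2 m (strip_cell m x)}"
  proof cases
    case up
    have "((e + 7) mod 8 + c) mod 8 = (k + 7) mod 8"
      unfolding k_def mod_add_left_eq by (simp add: algebra_simps)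
    then have "strip_cell m (strip_step T m x) =
        ((k + 7) mod 8 mod 4, if (k + 7) mod 8 < 4 then c else c + m)"
      using up by (simp add: ce(1) strip_step_def strip_cell_def Let_def)
    also have "\<dots> = grid_up 2 m (strip_cell m x)"
      unfolding row using k shift by (elim insertE emptyE) simp_all
    finally show ?thesis by simp
  next
    case right
    have "((e + 7) mod 8 + (c + 1)) mod 8 = (e + c + 8) mod 8"
      by (simp only: mod_add_left_eq) (simp add: algebra_simps)
    then have "((e + 7) mod 8 + (c + 1)) mod 8 = k"
      by (simp add: k_def)
    then have "strip_cell m (strip_step T m x) = (k mod 4, if k < 4 then c + 1 else c + 1 + m)"
      using right by (simp add: ce(1) strip_step_def strip_cell_def Let_def)
    also have "\<dots> = grid_right 2 m (strip_cell m x)"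
      unfolding row using right(2) by auto
    finally show ?thesis by simp
  next
    case wrap
    have "(e + m mod 8 + 7) mod 8 = (e + m + 7) mod 8"
      by (rule mod_add_cong[OF mod_add_right_eq refl])
    also have "e + m + 7 = e + c + 8"
      using wrap(2) by simp
    finally have "(e + m mod 8 + 7) mod 8 = k"
      by (simp add: k_def)
    then have "strip_cell m (strip_step T m x) = strip_cell m (0, strip_twist k)"
      using wrap by (simp add: ce(1) strip_step_def)
    also have "\<dots> = grid_right 2 m (strip_cell m x)"
      unfolding row unfolding strip_cell_def strip_twist_def using k wrap(2)
      by (elim insertE emptyE) (simp_all add: Let_def)
    finally show ?thesis by simp
  qed
  with cell show ?thesis
    by (auto simp: two_holed_grid_def simp del: grid_up.simps grid_right.simps split_paired_Ex)
qed

section \<open>Orbits that cover the strip\<close>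

lemma strip_step_in:
  assumes "x \<in> {0..<m} \<times> {0..<8}"
  shows "strip_step T m x \<in> {0..<m} \<times> {0..<8}"
  using assms by (auto simp: strip_step_def strip_twist_def)

text \<open>A cell on diagonal \<open>e\<close> is an entry of its column if \<open>e + 1\<close>
  lies in \<open>T\<close>, and otherwise follows the cell on \<open>e + 1\<close> by an up step. So
  the entries generate their column, and a full column yields the entries of the next.\<close>

lemma strip_step_closed_covers:
  assumes closed: "\<And>x. x \<in> S \<Longrightarrow> strip_step T m x \<in> S"
    and T: "T \<noteq> {}" "T \<subseteq> {0..<8}"
    and entries: "\<And>e. e \<in> T \<Longrightarrow> (0, (e + 7) mod 8) \<in> S"
  shows "{0..<m} \<times> {0..<8} \<subseteq> S"
proof -
  have column: "(c, e) \<in> S"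
    if ent: "\<And>e. e \<in> T \<Longrightarrow> (c, (e + 7) mod 8) \<in> S" and e: "e < 8" for c e
  proof -
    \<comment> \<open>\<open>d\<close> measures how far back from \<open>e + 1\<close> a diagonal of
      \<open>T\<close> lies; the induction traces the up steps from there.\<close>
    have fill: "(c, e) \<in> S" if "(e + 1 + d) mod 8 \<in> T" "e < 8" for d e
      using that
    proof (induction d arbitrary: e)
      case 0
      have "((e + 1) mod 8 + 7) mod 8 = e"
        using 0 by (simp add: mod_add_left_eq)
      then show ?case
        using ent[of "(e + 1) mod 8"] 0 by simp
    next
      case (Suc d)
      let ?e = "(e + 1) mod 8"
      have prev: "(?e + 7) mod 8 = e"
        using Suc.prems(2) by (simp add: mod_add_left_eq)
      have "(?e + 1 + d) mod 8 = (e + 1 + Suc d) mod 8"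
        unfolding add.assoc[of ?e] mod_add_left_eq by simp
      then have in_S: "(c, ?e) \<in> S"
        using Suc by simp
      show ?case
      proof (cases "?e \<in> T")
        case True
        then show ?thesis using ent[of ?e] prev by simp
      next
        case False
        then show ?thesis using closed[OF in_S] prev by (simp add: strip_step_def)
      qed
    qed
    obtain t where t: "t \<in> T" "t < 8"
      using T by (metis atLeastLessThan_iff ex_in_conv subsetD)
    \<comment> \<open>The witness is \<open>t - e - 1\<close> plus 8, which avoids truncated
      subtraction.\<close>
    have "(e + 1 + (t + 7 - e)) mod 8 = t"
      using e t by simp
    with fill[of e "t + 7 - e"] t e show ?thesis by simp
  qed
  have "\<forall>e<8. (c, e) \<in> S" if "c < m" for c
    using that
  proof (induction c)
    case 0
    then show ?case using column entries by blast
  next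
    case (Suc c)
    have "(Suc c, (e + 7) mod 8) \<in> S" if "e \<in> T" for e
      using closed[of "(c, e)"] Suc that T by (auto simp: strip_step_def)
    then show ?case using column by blast
  qed
  then show ?thesis by auto
qed

lemma hamiltonian_cycle_if_strip_entries:
  assumes T: "T \<noteq> {}" "T \<subseteq> {0..<8}"
    and m: "m > 0"
    and e0: "e0 < 8" "(0, e0) \<in> orbit (strip_step T m) (0, e0)"
    and entries: "\<And>e. e \<in> T \<Longrightarrow> (0, (e + 7) mod 8) \<in> orbit (strip_step T m) (0, e0)"
  shows "\<exists>p. pre_digraph.hamiltonian_cycle (two_holed_grid 2 m) p"
proof -
  interpret fin_digraph "two_holed_grid 2 m"
    using m by (simp add: fin_digraph_two_holed_grid)
  let ?O = "orbit (strip_step T m) (0, e0)"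
  have "y \<in> {0..<m} \<times> {0..<8}" if "y \<in> ?O" for y
    using that
  proof induction
    case base
    show ?case using m e0 by (intro strip_step_in) auto
  next
    case (step y)
    then show ?case by (intro strip_step_in)
  qed
  moreover have "{0..<m} \<times> {0..<8} \<subseteq> ?O"
    using T entries by (intro strip_step_closed_covers[of _ T m]) (auto intro: orbit.step)
  ultimately have O: "?O = {0..<m} \<times> {0..<8}"
    by blast
  show ?thesis
  proof (rule hamiltonian_cycle_if_orbit)
    show "bij_betw (strip_cell m) ?O (verts (two_holed_grid 2 m))"
      using bij_betw_strip_cell by (simp add: O two_holed_grid_def)
    show "\<exists>a\<in>arcs (two_holed_grid 2 m). tail (two_holed_grid 2 m) a = strip_cell m y \<and>
        head (two_holed_grid 2 m) a = strip_cell m (strip_step T m y)" if "y \<in> ?O" for y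
      using strip_step_arc[of y m T] that unfolding O
      by (intro bexI[where x = "(strip_cell m y, strip_cell m (strip_step T m y))"])
        (simp_all add: two_holed_grid_def)
  qed (fact e0)
qed

section \<open>Laps along the strip and the residue classes\<close>

text \<open>
  Eight steps meet every diagonal once, so within the strip they lead prev to the same diagonal,
  and the column advances by the number \<open>h\<close> of diagonals in \<open>T\<close>.
\<close>

lemma strip_lap:
  assumes block: "\<And>c. c + h < m \<Longrightarrow> (strip_step T m ^^ 8) (c, e) = (c + h, e)"
    and d: "h dvd d" "d < m"
    and last: "(strip_step T m ^^ k) (d, e) = (0, e')" "k > 0"
  shows "(0, e') \<in> orbit (strip_step T m) (0, e)"
proof -
  obtain j where j: "d = h * j"
    using d(1) by (rule dvdE)
  have "(strip_step T m ^^ (8 * j)) (0, e) = (h * j, e)"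
    using d(2) unfolding j
  proof (induction j)
    case (Suc j)
    have "(strip_step T m ^^ (8 * Suc j)) (0, e) =
        (strip_step T m ^^ 8) ((strip_step T m ^^ (8 * j)) (0, e))"
      by (simp flip: funpow_add o_apply[of "strip_step T m ^^ 8"])
    then show ?case
      using Suc block[of "h * j"] by (simp add: add.commute)
  qed simp
  with last have "(strip_step T m ^^ (k + 8 * j)) (0, e) = (0, e')"
    by (simp add: funpow_add j)
  then show ?thesis
    using last(2) unfolding orbit_altdef by (intro CollectI exI[of _ "k + 8 * j"]) simp
qed

text \<open>Peeling off the innermost application lets the simplifier run the steps one by one on
  explicit pairs.\<close>

lemma funpow_numeral_apply: "(f ^^ numeral k) x = (f ^^ pred_numeral k) (f x)"
  by (simp only: numeral_eq_Suc funpow_Suc_right o_apply)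

lemma strip_step_simps:
  "e \<notin> T \<Longrightarrow> strip_step T m (c, e) = (c, (e + 7) mod 8)"
  "e \<in> T \<Longrightarrow> c + 1 < m \<Longrightarrow> strip_step T m (c, e) = (c + 1, (e + 7) mod 8)"
  "e \<in> T \<Longrightarrow> m \<le> c + 1 \<Longrightarrow>
    strip_step T m (c, e) = (0, strip_twist ((e + m mod 8 + 7) mod 8))"
  by (simp_all add: strip_step_def)

lemmas strip_step_eval = funpow_numeral_apply strip_step_simps

text \<open>The only entry diagonal is \<open>t - 1\<close>: seven up steps lead to
  \<open>t\<close>, the eighth step goes right. By \<open>w\<close> the twist returns to the same
  entry.\<close>

lemma hamiltonian_cycle_if_single_diagonal:
  assumes m: "m > 0" and T: "t \<in> {1, 4, 7}"
    and w: "strip_twist ((t + m mod 8 + 7) mod 8) = (t + 7) mod 8"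
  shows "\<exists>p. pre_digraph.hamiltonian_cycle (two_holed_grid 2 m) p"
proof -
  have "(0, (t + 7) mod 8) \<in> orbit (strip_step {t} m) (0, (t + 7) mod 8)"
  proof (rule strip_lap[where h = 1 and d = "m - 1" and k = 8])
    show "(strip_step {t} m ^^ 8) (c, (t + 7) mod 8) = (c + 1, (t + 7) mod 8)"
      if "c + 1 < m" for c
      using T that by (elim insertE emptyE) (simp_all add: strip_step_eval)
    show "(strip_step {t} m ^^ 8) (m - 1, (t + 7) mod 8) = (0, (t + 7) mod 8)"
      using T w by (elim insertE emptyE) (simp_all add: strip_step_eval)
  qed (use m in auto)
  then show ?thesis
    using T m by (intro hamiltonian_cycle_if_strip_entries[of "{t}" m "(t + 7) mod 8"]) auto
qed

text \<open>One run through the strip takes each entry of column 0 to the next in the order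
  \<open>ea\<close>, \<open>eb\<close>, \<open>ec\<close>, \<open>ed\<close>, \<open>ea\<close>, so
  all of them lie on one orbit.\<close>

lemma hamiltonian_cycle_if_four_diagonals:
  assumes T: "T \<noteq> {}" "T \<subseteq> {0..<8}" "\<forall>e\<in>T. (e + 7) mod 8 \<in> {ea, eb, ec, ed}" "ea < 8"
    and d: "4 dvd d" "d < m"
    and block: "\<And>c e. \<lbrakk>c + 4 < m; e \<in> {ea, eb, ec, ed}\<rbrakk> \<Longrightarrow>
      (strip_step T m ^^ 8) (c, e) = (c + 4, e)"
    and last: "(strip_step T m ^^ ka) (d, ea) = (0, eb)" "(strip_step T m ^^ kb) (d, eb) = (0, ec)"
      "(strip_step T m ^^ kc) (d, ec) = (0, ed)" "(strip_step T m ^^ kd) (d, ed) = (0, ea)"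
    and k: "ka > 0" "kb > 0" "kc > 0" "kd > 0"
  shows "\<exists>p. pre_digraph.hamiltonian_cycle (two_holed_grid 2 m) p"
proof -
  let ?O = "\<lambda>e. orbit (strip_step T m) (0, e)"
  have "(0, eb) \<in> ?O ea" "(0, ec) \<in> ?O eb" "(0, ed) \<in> ?O ec" "(0, ea) \<in> ?O ed"
    using strip_lap[OF block d last(1) k(1)] strip_lap[OF block d last(2) k(2)]
      strip_lap[OF block d last(3) k(3)] strip_lap[OF block d last(4) k(4)] by simp_all
  then have "(0, e) \<in> ?O ea" if "e \<in> {ea, eb, ec, ed}" for e
    using that by (blast intro: orbit_trans)
  then show ?thesis
    using T d(2) by (intro hamiltonian_cycle_if_strip_entries[of T m ea]) auto
qed

theorem proposition15:
  fixes m :: nat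
  assumes "m > 0"
    and "m mod 8 \<in> {0, 1, 2, 4, 6, 7}"
  shows "\<exists>p. pre_digraph.hamiltonian_cycle (two_holed_grid 2 m) p"
proof -
  have div: "8 * (m div 8) + m mod 8 = m"
    by simp
  consider "m mod 8 = 0" | "m mod 8 = 1" | "m mod 8 = 2" | "m mod 8 = 4" | "m mod 8 = 6"
    | "m mod 8 = 7"
    using assms(2) by auto
  then show ?thesis
  proof cases
    case 1
    \<comment> \<open>Here and in the other four-diagonal cases \<open>d\<close> is the largest
      multiple of 4 below \<open>m\<close>; the exponents count the steps from column
      \<open>d\<close> until the last column is left.\<close>
    define d where "d = 8 * (m div 8) - 4"
    have d: "4 dvd d" "d + 4 = m"
      using assms(1) div 1 by (auto simp: d_def)
    show ?thesis
    proof (rule hamiltonian_cycle_if_four_diagonals[where T = "{0, 2, 4, 6}" and d = d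
          and ea = 1 and eb = 5 and ec = 3 and ed = 7
          and ka = 8 and kb = 8 and kc = 8 and kd = 8])
      show "(strip_step {0, 2, 4, 6} m ^^ 8) (c, e) = (c + 4, e)"
        if "c + 4 < m" "e \<in> {1, 5, 3, 7}" for c e
        using that(2,1) by (elim insertE emptyE) (simp_all add: strip_step_eval)
    qed (use d 1 in \<open>simp_all add: strip_step_eval strip_twist_def\<close>)
  next
    case 2
    define d where "d = 8 * (m div 8)"
    have d: "4 dvd d" "d + 1 = m"
      using assms(1) div 2 by (auto simp: d_def)
    show ?thesis
    proof (rule hamiltonian_cycle_if_four_diagonals[where T = "{1, 2, 6, 7}" and d = d
          and ea = 0 and eb = 1 and ec = 5 and ed = 6
          and ka = 2 and kb = 1 and kc = 4 and kd = 1])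
      show "(strip_step {1, 2, 6, 7} m ^^ 8) (c, e) = (c + 4, e)"
        if "c + 4 < m" "e \<in> {0, 1, 5, 6}" for c e
        using that(2,1) by (elim insertE emptyE) (simp_all add: strip_step_eval)
    qed (use d 2 in \<open>simp_all add: strip_step_eval strip_twist_def\<close>)
  next
    case 3
    then show ?thesis
      using assms by (intro hamiltonian_cycle_if_single_diagonal[of m 4]) (simp_all add: strip_twist_def)
  next
    case 4
    then show ?thesis
      using assms by (intro hamiltonian_cycle_if_single_diagonal[of m 7]) (simp_all add: strip_twist_def)
  next
    case 5
    then show ?thesis
      using assms by (intro hamiltonian_cycle_if_single_diagonal[of m 1]) (simp_all add: strip_twist_def)
  next
    case 6
    define d where "d = 8 * (m div 8) + 4"
    have d: "4 dvd d" "d + 3 = m"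
      using assms(1) div 6 by (auto simp: d_def)
    show ?thesis
    \<comment> \<open>Three columns remain from \<open>d\<close> on, so the third diagonal of
      \<open>T\<close> met leads across the twist.\<close>
    proof (rule hamiltonian_cycle_if_four_diagonals[where T = "{3, 4, 6, 7}" and d = d
          and ea = 2 and eb = 6 and ec = 5 and ed = 3
          and ka = 7 and kb = 4 and kc = 7 and kd = 6])
      show "(strip_step {3, 4, 6, 7} m ^^ 8) (c, e) = (c + 4, e)"
        if "c + 4 < m" "e \<in> {2, 6, 5, 3}" for c e
        using that(2,1) by (elim insertE emptyE) (simp_all add: strip_step_eval)
    qed (use d 6 in \<open>simp_all add: strip_step_eval strip_twist_def\<close>)
  qed
qed

end
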